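(* $\mathrm{CHL}$ is deductively equivalent to intuitionistic logic $\mathrm{IL}$. Explicitly, let $\tau$ map $\mathrm{CHL}$-formulas to $\mathrm{IL}$-formulas and $\rho$ map $\mathrm{IL}$-formulas to $\mathrm{CHL}$-formulas, both being the identity on variables and constants and commuting with $\wedge,\vee$, with $\tau(\varphi\rightarrow\psi)=(\tau\varphi\Rightarrow\tau\psi)\wedge(\neg\tau\varphi\Rightarrow\neg\tau\psi)$ (where in $\mathrm{IL}$, $\neg\chi:=\chi\Rightarrow 0$) and $\rho(\varphi\Rightarrow\psi)=\rho\varphi\rightarrow(\rho\varphi\wedge\rho\psi)$. Then for all sets of $\mathrm{CHL}$-formulas $\Gamma\cup\{\varphi\}$: (1) $\Gamma\vdash_{\mathrm{CHL}}\varphi$ iff $\tau(\Gamma)\vdash_{\mathrm{IL}}\tau(\varphi)$; and (2) for every $\mathrm{IL}$-formula $\varphi$, $\tau(\rho(\varphi))\dashv\vdash_{\mathrm{IL}}\varphi$.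
   Context: $\mathrm{IL}$ is intuitionistic propositional logic in the language $\wedge,\vee,\Rightarrow,0,1$ (with $\Rightarrow$ intuitionistic implication). $\mathrm{CHL}$ is the logic in the language $\wedge,\vee,\rightarrow,0,1$ given by the Hilbert system below, with abbreviations (inside $\mathrm{CHL}$) $\neg\varphi:=\varphi\rightarrow 0$, $\varphi\Rightarrow\psi:=\varphi\rightarrow(\varphi\wedge\psi)$, $\varphi\Leftrightarrow\psi:=(\varphi\Rightarrow\psi)\wedge(\psi\Rightarrow\varphi)$: (CHL1) any complete set of axioms and rules for positive intuitionistic logic with implication read as $\Rightarrow$ (including modus ponens for $\Rightarrow$); (CHL2) $\neg(0\wedge\varphi)$; (CHL3) $\neg\varphi\Rightarrow(0\rightarrow\varphi)$; (CHL4) $(\varphi\rightarrow\psi)\Rightarrow(\varphi\Rightarrow\psi)$; (CHL5) $(\varphi\rightarrow\psi)\rightarrow((\psi\rightarrow\chi)\rightarrow(\varphi\rightarrow\chi))$; (CHL6) $(\varphi\rightarrow\psi)\rightarrow\neg(\varphi\rightarrow\neg\psi)$; (CHL7) the rules $\varphi\Leftrightarrow\psi\vdash(\varphi\rightarrow\chi)\Rightarrow(\psi\rightarrow\chi)$ and $\varphi\Leftrightarrow\psi\vdash(\chi\rightarrow\varphi)\Rightarrow(\chi\rightarrow\psi)$; (CHL8) $\varphi\wedge\psi\Rightarrow\varphi\wedge(\varphi\rightarrow\psi)$; (CHL9) $(\varphi\rightarrow\psi)\Rightarrow((\varphi\wedge\chi)\rightarrow(\psi\wedge\chi))$; (CHL10)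 $(\varphi\rightarrow\psi)\Rightarrow((\varphi\vee\chi)\rightarrow(\psi\vee\chi))$. $\Gamma\dashv\vdash\Delta$ means mutual derivability. *)

theory Defs
  imports Main
begin

datatype 'v il_fm =
    IVar 'v
  | IZero (\<open>0\<^sub>I\<close>)
  | IOne (\<open>1\<^sub>I\<close>)
  | IAnd "'v il_fm" "'v il_fm" (infixr \<open>\<and>\<^sub>I\<close> 75)
  | IOr "'v il_fm" "'v il_fm" (infixr \<open>\<or>\<^sub>I\<close> 70)
  | IImp "'v il_fm" "'v il_fm" (infixr \<open>\<Rightarrow>\<^sub>I\<close> 65)

abbreviation INot :: "'v il_fm \<Rightarrow> 'v il_fm" (\<open>\<not>\<^sub>I _\<close> [80] 80) where
  "\<not>\<^sub>I \<phi> \<equiv> \<phi> \<Rightarrow>\<^sub>I 0\<^sub>I"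

inductive il_derives :: "'v il_fm set \<Rightarrow> 'v il_fm \<Rightarrow> bool" (infix \<open>\<turnstile>\<^sub>I\<^sub>L\<close> 55)
  for \<Gamma> :: "'v il_fm set" where
  il_hyp: "\<phi> \<in> \<Gamma> \<Longrightarrow> \<Gamma> \<turnstile>\<^sub>I\<^sub>L \<phi>"
| il_K: "\<Gamma> \<turnstile>\<^sub>I\<^sub>L \<phi> \<Rightarrow>\<^sub>I (\<psi> \<Rightarrow>\<^sub>I \<phi>)"
| il_S: "\<Gamma> \<turnstile>\<^sub>I\<^sub>L (\<phi> \<Rightarrow>\<^sub>I (\<psi> \<Rightarrow>\<^sub>I \<chi>)) \<Rightarrow>\<^sub>I ((\<phi> \<Rightarrow>\<^sub>I \<psi>) \<Rightarrow>\<^sub>I (\<phi> \<Rightarrow>\<^sub>I \<chi>))"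
| il_conjE1: "\<Gamma> \<turnstile>\<^sub>I\<^sub>L (\<phi> \<and>\<^sub>I \<psi>) \<Rightarrow>\<^sub>I \<phi>"
| il_conjE2: "\<Gamma> \<turnstile>\<^sub>I\<^sub>L (\<phi> \<and>\<^sub>I \<psi>) \<Rightarrow>\<^sub>I \<psi>"
| il_conjI: "\<Gamma> \<turnstile>\<^sub>I\<^sub>L \<phi> \<Rightarrow>\<^sub>I (\<psi> \<Rightarrow>\<^sub>I (\<phi> \<and>\<^sub>I \<psi>))"
| il_disjI1: "\<Gamma> \<turnstile>\<^sub>I\<^sub>L \<phi> \<Rightarrow>\<^sub>I (\<phi> \<or>\<^sub>I \<psi>)"
| il_disjI2: "\<Gamma> \<turnstile>\<^sub>I\<^sub>L \<psi> \<Rightarrow>\<^sub>I (\<phi> \<or>\<^sub>I \<psi>)"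
| il_disjE: "\<Gamma> \<turnstile>\<^sub>I\<^sub>L (\<phi> \<Rightarrow>\<^sub>I \<chi>) \<Rightarrow>\<^sub>I ((\<psi> \<Rightarrow>\<^sub>I \<chi>) \<Rightarrow>\<^sub>I ((\<phi> \<or>\<^sub>I \<psi>) \<Rightarrow>\<^sub>I \<chi>))"
| il_one: "\<Gamma> \<turnstile>\<^sub>I\<^sub>L 1\<^sub>I"
| il_zero: "\<Gamma> \<turnstile>\<^sub>I\<^sub>L 0\<^sub>I \<Rightarrow>\<^sub>I \<phi>"
| il_mp: "\<Gamma> \<turnstile>\<^sub>I\<^sub>L \<phi> \<Longrightarrow> \<Gamma> \<turnstile>\<^sub>I\<^sub>L \<phi> \<Rightarrow>\<^sub>I \<psi> \<Longrightarrow> \<Gamma> \<turnstile>\<^sub>I\<^sub>L \<psi>"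

definition il_interderivable :: "'v il_fm set \<Rightarrow> 'v il_fm set \<Rightarrow> bool"
    (infix \<open>\<stileturn>\<turnstile>\<^sub>I\<^sub>L\<close> 55) where
  "\<Gamma> \<stileturn>\<turnstile>\<^sub>I\<^sub>L \<Delta> \<longleftrightarrow> (\<forall>\<delta>\<in>\<Delta>. \<Gamma> \<turnstile>\<^sub>I\<^sub>L \<delta>) \<and> (\<forall>\<gamma>\<in>\<Gamma>. \<Delta> \<turnstile>\<^sub>I\<^sub>L \<gamma>)"

datatype 'v chl_fm =
    CVar 'v
  | CZero (\<open>0\<^sub>C\<close>)
  | COne (\<open>1\<^sub>C\<close>)
  | CAnd "'v chl_fm" "'v chl_fm" (infixr \<open>\<and>\<^sub>C\<close> 75)
  | COr "'v chl_fm" "'v chl_fm" (infixr \<open>\<or>\<^sub>C\<close> 70)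
  | CArrow "'v chl_fm" "'v chl_fm" (infixr \<open>\<rightarrow>\<^sub>C\<close> 65)

abbreviation CNot :: "'v chl_fm \<Rightarrow> 'v chl_fm" (\<open>\<not>\<^sub>C _\<close> [80] 80) where
  "\<not>\<^sub>C \<phi> \<equiv> \<phi> \<rightarrow>\<^sub>C 0\<^sub>C"

abbreviation CImp :: "'v chl_fm \<Rightarrow> 'v chl_fm \<Rightarrow> 'v chl_fm" (infixr \<open>\<Rightarrow>\<^sub>C\<close> 65) where
  "\<phi> \<Rightarrow>\<^sub>C \<psi> \<equiv> \<phi> \<rightarrow>\<^sub>C (\<phi> \<and>\<^sub>C \<psi>)"

abbreviation CIff :: "'v chl_fm \<Rightarrow> 'v chl_fm \<Rightarrow> 'v chl_fm" (infix \<open>\<Leftrightarrow>\<^sub>C\<close> 65) where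
  "\<phi> \<Leftrightarrow>\<^sub>C \<psi> \<equiv> (\<phi> \<Rightarrow>\<^sub>C \<psi>) \<and>\<^sub>C (\<psi> \<Rightarrow>\<^sub>C \<phi>)"

text \<open>
  The clauses \<open>CHL1_*\<close> are a standard complete Hilbert system for positive intuitionistic logic
  (with top) whose implication is the defined \<open>\<Rightarrow>\<^sub>C\<close>; any other complete system yields the same
  consequence relation. The rules \<open>CHL7_*\<close> apply to arbitrary derivable premises, not only to
  theorems.
\<close>

inductive chl_derives :: "'v chl_fm set \<Rightarrow> 'v chl_fm \<Rightarrow> bool" (infix \<open>\<turnstile>\<^sub>C\<^sub>H\<^sub>L\<close> 55)
  for \<Gamma> :: "'v chl_fm set" where
  CHL_hyp: "\<phi> \<in> \<Gamma> \<Longrightarrow> \<Gamma> \<turnstile>\<^sub>C\<^sub>H\<^sub>L \<phi>"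
| CHL1_K: "\<Gamma> \<turnstile>\<^sub>C\<^sub>H\<^sub>L \<phi> \<Rightarrow>\<^sub>C (\<psi> \<Rightarrow>\<^sub>C \<phi>)"
| CHL1_S: "\<Gamma> \<turnstile>\<^sub>C\<^sub>H\<^sub>L (\<phi> \<Rightarrow>\<^sub>C (\<psi> \<Rightarrow>\<^sub>C \<chi>)) \<Rightarrow>\<^sub>C ((\<phi> \<Rightarrow>\<^sub>C \<psi>) \<Rightarrow>\<^sub>C (\<phi> \<Rightarrow>\<^sub>C \<chi>))"
| CHL1_conjE1: "\<Gamma> \<turnstile>\<^sub>C\<^sub>H\<^sub>L (\<phi> \<and>\<^sub>C \<psi>) \<Rightarrow>\<^sub>C \<phi>"
| CHL1_conjE2: "\<Gamma> \<turnstile>\<^sub>C\<^sub>H\<^sub>L (\<phi> \<and>\<^sub>C \<psi>) \<Rightarrow>\<^sub>C \<psi>"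
| CHL1_conjI: "\<Gamma> \<turnstile>\<^sub>C\<^sub>H\<^sub>L \<phi> \<Rightarrow>\<^sub>C (\<psi> \<Rightarrow>\<^sub>C (\<phi> \<and>\<^sub>C \<psi>))"
| CHL1_disjI1: "\<Gamma> \<turnstile>\<^sub>C\<^sub>H\<^sub>L \<phi> \<Rightarrow>\<^sub>C (\<phi> \<or>\<^sub>C \<psi>)"
| CHL1_disjI2: "\<Gamma> \<turnstile>\<^sub>C\<^sub>H\<^sub>L \<psi> \<Rightarrow>\<^sub>C (\<phi> \<or>\<^sub>C \<psi>)"
| CHL1_disjE: "\<Gamma> \<turnstile>\<^sub>C\<^sub>H\<^sub>L (\<phi> \<Rightarrow>\<^sub>C \<chi>) \<Rightarrow>\<^sub>C ((\<psi> \<Rightarrow>\<^sub>C \<chi>) \<Rightarrow>\<^sub>C ((\<phi> \<or>\<^sub>C \<psi>) \<Rightarrow>\<^sub>C \<chi>))"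
| CHL1_one: "\<Gamma> \<turnstile>\<^sub>C\<^sub>H\<^sub>L 1\<^sub>C"
| CHL1_mp: "\<Gamma> \<turnstile>\<^sub>C\<^sub>H\<^sub>L \<phi> \<Longrightarrow> \<Gamma> \<turnstile>\<^sub>C\<^sub>H\<^sub>L \<phi> \<Rightarrow>\<^sub>C \<psi> \<Longrightarrow> \<Gamma> \<turnstile>\<^sub>C\<^sub>H\<^sub>L \<psi>"
| CHL2: "\<Gamma> \<turnstile>\<^sub>C\<^sub>H\<^sub>L \<not>\<^sub>C (0\<^sub>C \<and>\<^sub>C \<phi>)"
| CHL3: "\<Gamma> \<turnstile>\<^sub>C\<^sub>H\<^sub>L \<not>\<^sub>C \<phi> \<Rightarrow>\<^sub>C (0\<^sub>C \<rightarrow>\<^sub>C \<phi>)"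
| CHL4: "\<Gamma> \<turnstile>\<^sub>C\<^sub>H\<^sub>L (\<phi> \<rightarrow>\<^sub>C \<psi>) \<Rightarrow>\<^sub>C (\<phi> \<Rightarrow>\<^sub>C \<psi>)"
| CHL5: "\<Gamma> \<turnstile>\<^sub>C\<^sub>H\<^sub>L (\<phi> \<rightarrow>\<^sub>C \<psi>) \<rightarrow>\<^sub>C ((\<psi> \<rightarrow>\<^sub>C \<chi>) \<rightarrow>\<^sub>C (\<phi> \<rightarrow>\<^sub>C \<chi>))"
| CHL6: "\<Gamma> \<turnstile>\<^sub>C\<^sub>H\<^sub>L (\<phi> \<rightarrow>\<^sub>C \<psi>) \<rightarrow>\<^sub>C \<not>\<^sub>C (\<phi> \<rightarrow>\<^sub>C \<not>\<^sub>C \<psi>)"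
| CHL7_left: "\<Gamma> \<turnstile>\<^sub>C\<^sub>H\<^sub>L \<phi> \<Leftrightarrow>\<^sub>C \<psi> \<Longrightarrow> \<Gamma> \<turnstile>\<^sub>C\<^sub>H\<^sub>L (\<phi> \<rightarrow>\<^sub>C \<chi>) \<Rightarrow>\<^sub>C (\<psi> \<rightarrow>\<^sub>C \<chi>)"
| CHL7_right: "\<Gamma> \<turnstile>\<^sub>C\<^sub>H\<^sub>L \<phi> \<Leftrightarrow>\<^sub>C \<psi> \<Longrightarrow> \<Gamma> \<turnstile>\<^sub>C\<^sub>H\<^sub>L (\<chi> \<rightarrow>\<^sub>C \<phi>) \<Rightarrow>\<^sub>C (\<chi> \<rightarrow>\<^sub>C \<psi>)"
| CHL8: "\<Gamma> \<turnstile>\<^sub>C\<^sub>H\<^sub>L (\<phi> \<and>\<^sub>C \<psi>) \<Rightarrow>\<^sub>C (\<phi> \<and>\<^sub>C (\<phi> \<rightarrow>\<^sub>C \<psi>))"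
| CHL9: "\<Gamma> \<turnstile>\<^sub>C\<^sub>H\<^sub>L (\<phi> \<rightarrow>\<^sub>C \<psi>) \<Rightarrow>\<^sub>C ((\<phi> \<and>\<^sub>C \<chi>) \<rightarrow>\<^sub>C (\<psi> \<and>\<^sub>C \<chi>))"
| CHL10: "\<Gamma> \<turnstile>\<^sub>C\<^sub>H\<^sub>L (\<phi> \<rightarrow>\<^sub>C \<psi>) \<Rightarrow>\<^sub>C ((\<phi> \<or>\<^sub>C \<chi>) \<rightarrow>\<^sub>C (\<psi> \<or>\<^sub>C \<chi>))"

primrec tau :: "'v chl_fm \<Rightarrow> 'v il_fm" (\<open>\<tau>\<close>) where
  "\<tau> (CVar v) = IVar v"
| "\<tau> 0\<^sub>C = 0\<^sub>I"
| "\<tau> 1\<^sub>C = 1\<^sub>I"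
| "\<tau> (\<phi> \<and>\<^sub>C \<psi>) = \<tau> \<phi> \<and>\<^sub>I \<tau> \<psi>"
| "\<tau> (\<phi> \<or>\<^sub>C \<psi>) = \<tau> \<phi> \<or>\<^sub>I \<tau> \<psi>"
| "\<tau> (\<phi> \<rightarrow>\<^sub>C \<psi>) = (\<tau> \<phi> \<Rightarrow>\<^sub>I \<tau> \<psi>) \<and>\<^sub>I (\<not>\<^sub>I \<tau> \<phi> \<Rightarrow>\<^sub>I \<not>\<^sub>I \<tau> \<psi>)"

primrec rho :: "'v il_fm \<Rightarrow> 'v chl_fm" (\<open>\<rho>\<close>) where
  "\<rho> (IVar v) = CVar v"
| "\<rho> 0\<^sub>I = 0\<^sub>C"
| "\<rho> 1\<^sub>I = 1\<^sub>C"
| "\<rho> (\<phi> \<and>\<^sub>I \<psi>) = \<rho> \<phi> \<and>\<^sub>C \<rho> \<psi>"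
| "\<rho> (\<phi> \<or>\<^sub>I \<psi>) = \<rho> \<phi> \<or>\<^sub>C \<rho> \<psi>"
| "\<rho> (\<phi> \<Rightarrow>\<^sub>I \<psi>) = \<rho> \<phi> \<rightarrow>\<^sub>C (\<rho> \<phi> \<and>\<^sub>C \<rho> \<psi>)"

end

theory Submission
  imports Defs
begin

text \<open>
  The deductively closed theories over a logic form a Kripke model: a set \<open>{b. a \<Rightarrow> b \<in> W}\<close> is the
  closed extension of \<open>W\<close> by \<open>a\<close>, so \<open>a \<Rightarrow> b \<in> W\<close> iff every closed extension of \<open>W\<close> containing
  \<open>a\<close> contains \<open>b\<close>. Arguments in either logic thus become arguments about membership.

  In CHL, transitivity (CHL5) with \<open>1 \<rightarrow> a\<close> equivalent to \<open>a\<close> gives \<open>a \<rightarrow> \<not>\<not>a\<close>, and CHL6 makes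
  \<open>0 \<rightarrow> 1\<close> absurd. From these, \<open>a \<rightarrow> b\<close> is equivalent to \<open>(a \<Rightarrow> b) \<and> (\<not>a \<Rightarrow> \<not>b)\<close>: if \<open>\<not>a\<close> then
  \<open>0 \<rightarrow> a \<rightarrow> b\<close>, which contradicts \<open>b\<close>; conversely \<open>a \<rightarrow> a \<and> b \<rightarrow> \<not>\<not>a \<and> b \<rightarrow> b\<close>.
  Hence \<open>\<rho> \<circ> \<tau>\<close> is the identity up to equivalence in CHL, and the rest is soundness of \<open>\<tau>\<close> and \<open>\<rho>\<close>.
\<close>

section \<open>Closed theories of a positive logic\<close>

locale positive_logic =
  fixes T :: "'f \<Rightarrow> bool"
    and imp conj disj :: "'f \<Rightarrow> 'f \<Rightarrow> 'f"
  assumes K: "T (imp a (imp b a))"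
    and S: "T (imp (imp a (imp b c)) (imp (imp a b) (imp a c)))"
    and conjE1: "T (imp (conj a b) a)"
    and conjE2: "T (imp (conj a b) b)"
    and conjI: "T (imp a (imp b (conj a b)))"
    and disjI1: "T (imp a (disj a b))"
    and disjI2: "T (imp b (disj a b))"
    and disjE: "T (imp (imp a c) (imp (imp b c) (imp (disj a b) c)))"
    and mp: "T a \<Longrightarrow> T (imp a b) \<Longrightarrow> T b"
begin

definition closed_theory :: "'f set \<Rightarrow> bool" where
  "closed_theory W \<longleftrightarrow> (\<forall>a. T a \<longrightarrow> a \<in> W) \<and> (\<forall>a b. a \<in> W \<longrightarrow> imp a b \<in> W \<longrightarrow> b \<in> W)"

lemma closed_theory_thm: "closed_theory W \<Longrightarrow> T a \<Longrightarrow> a \<in> W"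
  by (simp add: closed_theory_def)

lemma closed_theory_mp: "closed_theory W \<Longrightarrow> imp a b \<in> W \<Longrightarrow> a \<in> W \<Longrightarrow> b \<in> W"
  unfolding closed_theory_def by blast

lemma closed_theory_thm_mp: "closed_theory W \<Longrightarrow> T (imp a b) \<Longrightarrow> a \<in> W \<Longrightarrow> b \<in> W"
  using closed_theory_thm closed_theory_mp by blast

lemma closed_theory_theorems: "closed_theory {a. T a}"
  unfolding closed_theory_def using mp by blast

text \<open>\<open>K\<close> gives the inclusion, \<open>S\<close> gives closure under modus ponens,
  and the last claim is the combinator SKK. Together they do the work of a deduction
  theorem.\<close>

lemma closed_theory_extension:
  assumes "closed_theory W"
  shows "closed_theory {b. imp a b \<in> W}" "W \<subseteq> {b. imp a b \<in> W}" "imp a a \<in> W"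
proof -
  note mem = closed_theory_thm[OF assms] and mp = closed_theory_mp[OF assms]
  show sub: "W \<subseteq> {b. imp a b \<in> W}"
    using mp[OF mem[OF K]] by blast
  have "imp a c \<in> W" if "imp a b \<in> W" "imp a (imp b c) \<in> W" for b c
    using mp[OF mp[OF mem[OF S] that(2)] that(1)] .
  then show "closed_theory {b. imp a b \<in> W}"
    unfolding closed_theory_def using sub mem by blast
  show "imp a a \<in> W"
    using mp[OF mp[OF mem[OF S] mem[OF K]] mem[OF K]] .
qed

text \<open>From right to left, take for \<open>V\<close> the extension
  \<open>{b. imp a b \<in> W}\<close>.\<close>

lemma imp_mem_iff:
  assumes "closed_theory W"
  shows "imp a b \<in> W \<longleftrightarrow> (\<forall>V. closed_theory V \<longrightarrow> W \<subseteq> V \<longrightarrow> a \<in> V \<longrightarrow> b \<in> V)"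
  using closed_theory_extension[OF assms, of a] closed_theory_mp by blast

lemma thmI:
  assumes "\<And>W. closed_theory W \<Longrightarrow> a \<in> W"
  shows "T a"
  using assms closed_theory_theorems by blast

lemma thm_cong:
  assumes "\<And>W. closed_theory W \<Longrightarrow> a \<in> W \<longleftrightarrow> b \<in> W"
  shows "T a \<longleftrightarrow> T b"
  using assms closed_theory_theorems by blast

lemma conj_mem_iff:
  assumes "closed_theory W"
  shows "conj a b \<in> W \<longleftrightarrow> a \<in> W \<and> b \<in> W"
  by (meson assms closed_theory_mp closed_theory_thm conjE1 conjE2 conjI)

lemma disj_memI:
  assumes "closed_theory W" "a \<in> W \<or> b \<in> W"
  shows "disj a b \<in> W"
  by (meson assms closed_theory_mp closed_theory_thm disjI1 disjI2)

text \<open>Closed theories need not be prime, so neither disjunct has to lie in \<open>W\<close>;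
  the case split takes place in extensions instead.\<close>

lemma disj_memE:
  assumes "closed_theory W" "disj a b \<in> W"
    and "\<And>V. closed_theory V \<Longrightarrow> W \<subseteq> V \<Longrightarrow> a \<in> V \<Longrightarrow> c \<in> V"
    and "\<And>V. closed_theory V \<Longrightarrow> W \<subseteq> V \<Longrightarrow> b \<in> V \<Longrightarrow> c \<in> V"
  shows "c \<in> W"
proof -
  have "imp a c \<in> W" "imp b c \<in> W"
    using assms imp_mem_iff by blast+
  then show ?thesis
    by (meson assms(1,2) closed_theory_mp closed_theory_thm disjE)
qed

lemma disj_mem_cong:
  assumes "closed_theory W"
    and "\<And>V. closed_theory V \<Longrightarrow> a \<in> V \<longleftrightarrow> a' \<in> V"
    and "\<And>V. closed_theory V \<Longrightarrow> b \<in> V \<longleftrightarrow> b' \<in> V"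
  shows "disj a b \<in> W \<longleftrightarrow> disj a' b' \<in> W"
proof
  show "disj a' b' \<in> W" if "disj a b \<in> W"
    by (rule disj_memE[OF assms(1) that]) (simp_all add: assms disj_memI)
  show "disj a b \<in> W" if "disj a' b' \<in> W"
    by (rule disj_memE[OF assms(1) that]) (simp_all add: assms disj_memI)
qed

end

section \<open>The arrow of CHL\<close>

interpretation chl: positive_logic "\<lambda>\<phi>. \<Gamma> \<turnstile>\<^sub>C\<^sub>H\<^sub>L \<phi>" "\<lambda>\<phi> \<psi>. \<phi> \<Rightarrow>\<^sub>C \<psi>" CAnd COr for \<Gamma>
  by unfold_locales (rule chl_derives.intros; assumption)+

text \<open>CHL3 applied to the instance 0 \<and> \<phi> of CHL2 yields 0 \<rightarrow> (0 \<and>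
  \<phi>), which is literally 0 \<Rightarrow> \<phi>.\<close>

lemma chl_zero_mem:
  assumes "chl.closed_theory \<Gamma> W" "0\<^sub>C \<in> W"
  shows "\<phi> \<in> W"
  by (rule chl.closed_theory_thm_mp[OF assms(1) CHL1_mp[OF CHL2 CHL3] assms(2)])

lemma chl_arrow_mp:
  assumes "chl.closed_theory \<Gamma> W" "\<phi> \<rightarrow>\<^sub>C \<psi> \<in> W" "\<phi> \<in> W"
  shows "\<psi> \<in> W"
  by (rule chl.closed_theory_mp[OF assms(1) chl.closed_theory_thm_mp[OF assms(1) CHL4 assms(2)] assms(3)])

lemma chl_arrow_trans:
  assumes "chl.closed_theory \<Gamma> W" "\<phi> \<rightarrow>\<^sub>C \<psi> \<in> W" "\<psi> \<rightarrow>\<^sub>C \<chi> \<in> W"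
  shows "\<phi> \<rightarrow>\<^sub>C \<chi> \<in> W"
  by (rule chl_arrow_mp[OF assms(1) chl_arrow_mp[OF assms(1) chl.closed_theory_thm[OF assms(1) CHL5]
        assms(2)] assms(3)])

lemma chl_arrow_memI:
  assumes "chl.closed_theory \<Gamma> W" "\<phi> \<in> W" "\<psi> \<in> W"
  shows "\<phi> \<rightarrow>\<^sub>C \<psi> \<in> W"
  using chl.closed_theory_thm_mp[OF assms(1) CHL8, of \<phi> \<psi>] assms
  by (simp add: chl.conj_mem_iff)

lemma chl_arrow_conj:
  assumes "chl.closed_theory \<Gamma> W" "\<phi> \<rightarrow>\<^sub>C \<psi> \<in> W"
  shows "\<phi> \<and>\<^sub>C \<chi> \<rightarrow>\<^sub>C \<psi> \<and>\<^sub>C \<chi> \<in> W"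
  by (rule chl.closed_theory_thm_mp[OF assms(1) CHL9 assms(2)])

lemma chl_iff_thmI:
  assumes "\<And>V. chl.closed_theory \<Gamma> V \<Longrightarrow> \<phi> \<in> V \<longleftrightarrow> \<psi> \<in> V"
  shows "\<Gamma> \<turnstile>\<^sub>C\<^sub>H\<^sub>L \<phi> \<Leftrightarrow>\<^sub>C \<psi>"
  by (rule chl.thmI) (simp add: assms chl.conj_mem_iff chl.imp_mem_iff)

text \<open>CHL7 asks for a derivable equivalence, and a closed theory need not be closed under that
  rule. Hence agreement is assumed in all closed theories over \<Gamma>, not just in those extending
  \<open>W\<close>.\<close>

lemma chl_arrow_cong:
  assumes "chl.closed_theory \<Gamma> W" "\<phi> \<rightarrow>\<^sub>C \<psi> \<in> W"
    and "\<And>V. chl.closed_theory \<Gamma> V \<Longrightarrow> \<phi> \<in> V \<longleftrightarrow> \<phi>' \<in> V"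
    and "\<And>V. chl.closed_theory \<Gamma> V \<Longrightarrow> \<psi> \<in> V \<longleftrightarrow> \<psi>' \<in> V"
  shows "\<phi>' \<rightarrow>\<^sub>C \<psi>' \<in> W"
proof -
  have "\<Gamma> \<turnstile>\<^sub>C\<^sub>H\<^sub>L \<phi> \<Leftrightarrow>\<^sub>C \<phi>'" "\<Gamma> \<turnstile>\<^sub>C\<^sub>H\<^sub>L \<psi> \<Leftrightarrow>\<^sub>C \<psi>'"
    using assms(3,4) by (blast intro: chl_iff_thmI)+
  note imps = CHL7_left[OF this(1)] CHL7_right[OF this(2)]
  show ?thesis
    by (rule chl.closed_theory_thm_mp[OF assms(1) imps(2)],
        rule chl.closed_theory_thm_mp[OF assms(1) imps(1)], rule assms(2))
qed

text \<open>By ex falso \<phi> \<and> 0 is interchangeable with 0, so \<phi> \<Rightarrow> 0, that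
  is \<phi> \<rightarrow> (\<phi> \<and> 0), can be rewritten to \<phi> \<rightarrow> 0.\<close>

lemma chl_not_mem_iff:
  assumes "chl.closed_theory \<Gamma> W"
  shows "\<not>\<^sub>C \<phi> \<in> W \<longleftrightarrow> (\<forall>V. chl.closed_theory \<Gamma> V \<longrightarrow> W \<subseteq> V \<longrightarrow> \<phi> \<in> V \<longrightarrow> 0\<^sub>C \<in> V)"
proof
  assume "\<forall>V. chl.closed_theory \<Gamma> V \<longrightarrow> W \<subseteq> V \<longrightarrow> \<phi> \<in> V \<longrightarrow> 0\<^sub>C \<in> V"
  then have "\<phi> \<Rightarrow>\<^sub>C 0\<^sub>C \<in> W"
    using assms chl.imp_mem_iff by blast
  then show "\<not>\<^sub>C \<phi> \<in> W"
    by (rule chl_arrow_cong[OF assms]) (auto simp: chl.conj_mem_iff chl_zero_mem)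
qed (use chl_arrow_mp in blast)

lemma chl_one_mem: "chl.closed_theory \<Gamma> W \<Longrightarrow> 1\<^sub>C \<in> W"
  by (rule chl.closed_theory_thm[OF _ CHL1_one])

lemma chl_arrow_refl:
  assumes "chl.closed_theory \<Gamma> W"
  shows "\<phi> \<rightarrow>\<^sub>C \<phi> \<in> W"
  using chl.closed_theory_extension(3)[OF assms]
  by (rule chl_arrow_cong[OF assms]) (auto simp: chl.conj_mem_iff)

lemma chl_one_arrow_mem_iff:
  assumes "chl.closed_theory \<Gamma> W"
  shows "1\<^sub>C \<rightarrow>\<^sub>C \<phi> \<in> W \<longleftrightarrow> \<phi> \<in> W"
  using chl_arrow_memI[OF assms] chl_arrow_mp[OF assms] chl_one_mem[OF assms] by blast

lemma chl_zero_arrow_contradiction: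
  assumes W: "chl.closed_theory \<Gamma> W" and "0\<^sub>C \<rightarrow>\<^sub>C \<phi> \<in> W" "\<phi> \<in> W"
  shows "0\<^sub>C \<in> W"
proof -
  have "0\<^sub>C \<rightarrow>\<^sub>C 1\<^sub>C \<in> W"
    by (rule chl_arrow_trans[OF W assms(2) chl_arrow_memI[OF W assms(3) chl_one_mem[OF W]]])
  then have "\<not>\<^sub>C (0\<^sub>C \<rightarrow>\<^sub>C \<not>\<^sub>C 1\<^sub>C) \<in> W"
    by (rule chl_arrow_mp[OF W chl.closed_theory_thm[OF W CHL6]])
  \<comment> \<open>The negation of 1 is 1 \<rightarrow> 0, interchangeable with 0, so this is 0
    \<rightarrow> 0 in disguise.\<close>
  moreover have "0\<^sub>C \<rightarrow>\<^sub>C \<not>\<^sub>C 1\<^sub>C \<in> W"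
    using chl_arrow_refl[OF W] by (rule chl_arrow_cong[OF W]) (auto simp: chl_one_arrow_mem_iff)
  ultimately show ?thesis
    by (rule chl_arrow_mp[OF W])
qed

lemma chl_arrow_not_not:
  assumes "chl.closed_theory \<Gamma> W"
  shows "\<phi> \<rightarrow>\<^sub>C \<not>\<^sub>C \<not>\<^sub>C \<phi> \<in> W"
proof -
  have not_not: "\<not>\<^sub>C \<phi> \<rightarrow>\<^sub>C \<not>\<^sub>C 1\<^sub>C \<in> V \<longleftrightarrow> \<not>\<^sub>C \<not>\<^sub>C \<phi> \<in> V" if V: "chl.closed_theory \<Gamma> V" for V
    by (rule iffI; erule chl_arrow_cong[OF V]) (auto simp: chl_one_arrow_mem_iff)
  \<comment> \<open>This is CHL5 for 1, \<phi>, 0. Replacing 1 \<rightarrow> \<phi> by \<phi> and 1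
    \<rightarrow> 0 by 0 turns it into the goal.\<close>
  have "(1\<^sub>C \<rightarrow>\<^sub>C \<phi>) \<rightarrow>\<^sub>C (\<not>\<^sub>C \<phi> \<rightarrow>\<^sub>C \<not>\<^sub>C 1\<^sub>C) \<in> W"
    by (rule chl.closed_theory_thm[OF assms CHL5])
  then show ?thesis
    by (rule chl_arrow_cong[OF assms]) (rule chl_one_arrow_mem_iff not_not; assumption)+
qed

lemma chl_arrow_mem_iff:
  assumes W: "chl.closed_theory \<Gamma> W"
  shows "\<phi> \<rightarrow>\<^sub>C \<psi> \<in> W \<longleftrightarrow> \<phi> \<Rightarrow>\<^sub>C \<psi> \<in> W \<and> \<not>\<^sub>C \<phi> \<Rightarrow>\<^sub>C \<not>\<^sub>C \<psi> \<in> W"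
proof (intro iffI conjI)
  assume arrow: "\<phi> \<rightarrow>\<^sub>C \<psi> \<in> W"
  then show "\<phi> \<Rightarrow>\<^sub>C \<psi> \<in> W"
    by (rule chl.closed_theory_thm_mp[OF W CHL4])
  have "0\<^sub>C \<in> U" if U: "chl.closed_theory \<Gamma> U" "W \<subseteq> U" "\<not>\<^sub>C \<phi> \<in> U" "\<psi> \<in> U" for U
  proof -
    have "0\<^sub>C \<rightarrow>\<^sub>C \<phi> \<in> U"
      by (rule chl.closed_theory_thm_mp[OF U(1) CHL3 U(3)])
    then have "0\<^sub>C \<rightarrow>\<^sub>C \<psi> \<in> U"
      by (rule chl_arrow_trans[OF U(1)]) (use arrow U(2) in blast)
    then show ?thesis
      by (rule chl_zero_arrow_contradiction[OF U(1) _ U(4)])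
  qed
  then show "\<not>\<^sub>C \<phi> \<Rightarrow>\<^sub>C \<not>\<^sub>C \<psi> \<in> W"
    using W by (simp add: chl.imp_mem_iff chl_not_mem_iff)
next
  assume "\<phi> \<Rightarrow>\<^sub>C \<psi> \<in> W \<and> \<not>\<^sub>C \<phi> \<Rightarrow>\<^sub>C \<not>\<^sub>C \<psi> \<in> W"
  then have imp: "\<phi> \<Rightarrow>\<^sub>C \<psi> \<in> W" and not_imp: "\<not>\<^sub>C \<phi> \<Rightarrow>\<^sub>C \<not>\<^sub>C \<psi> \<in> W"
    by auto
  \<comment> \<open>The second hypothesis enters only through this contrapositive. As a member of
    \<open>W\<close> it can stand in for 1, which gives the last link of the chain of arrows from
    \<phi> to \<psi>.\<close>
  define \<eta> where "\<eta> = \<psi> \<Rightarrow>\<^sub>C \<not>\<^sub>C \<not>\<^sub>C \<phi>"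
  have "0\<^sub>C \<in> U" if U: "chl.closed_theory \<Gamma> U" "W \<subseteq> U" "\<psi> \<in> U" "\<not>\<^sub>C \<phi> \<in> U" for U
  proof -
    have "\<not>\<^sub>C \<psi> \<in> U"
      using chl.closed_theory_mp[OF U(1)] not_imp U(2,4) by blast
    then show ?thesis
      using chl_arrow_mp[OF U(1)] U(3) by blast
  qed
  then have \<eta>: "\<eta> \<in> W"
    using W unfolding \<eta>_def by (simp add: chl.imp_mem_iff chl_not_mem_iff[of \<Gamma> _ "\<not>\<^sub>C \<phi>"]) blast
  have 1: "\<phi> \<and>\<^sub>C \<psi> \<rightarrow>\<^sub>C \<not>\<^sub>C \<not>\<^sub>C \<phi> \<and>\<^sub>C \<psi> \<in> W"
    by (rule chl_arrow_conj[OF W chl_arrow_not_not[OF W]])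
  have "\<not>\<^sub>C \<not>\<^sub>C \<phi> \<and>\<^sub>C \<psi> \<Rightarrow>\<^sub>C \<eta> \<in> W"
    by (rule chl.closed_theory_thm_mp[OF W CHL1_K \<eta>])
  \<comment> \<open>The unfolded implication points to the conjunction of its premise with \<eta>;
    there the double negation of \<phi> is redundant, since it follows from \<eta> and
    \<psi>.\<close>
  then have 2: "\<not>\<^sub>C \<not>\<^sub>C \<phi> \<and>\<^sub>C \<psi> \<rightarrow>\<^sub>C \<eta> \<and>\<^sub>C \<psi> \<in> W"
  proof (rule chl_arrow_cong[OF W])
    fix V assume V: "chl.closed_theory \<Gamma> V"
    have "\<not>\<^sub>C \<not>\<^sub>C \<phi> \<in> V" if "\<eta> \<in> V" "\<psi> \<in> V"
      using chl.closed_theory_mp[OF V] that unfolding \<eta>_def by blast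
    then show "(\<not>\<^sub>C \<not>\<^sub>C \<phi> \<and>\<^sub>C \<psi>) \<and>\<^sub>C \<eta> \<in> V \<longleftrightarrow> \<eta> \<and>\<^sub>C \<psi> \<in> V"
      by (auto simp: chl.conj_mem_iff[OF V])
  qed simp
  have "\<eta> \<rightarrow>\<^sub>C 1\<^sub>C \<in> W"
    by (rule chl_arrow_memI[OF W \<eta> chl_one_mem[OF W]])
  then have "\<eta> \<and>\<^sub>C \<psi> \<rightarrow>\<^sub>C 1\<^sub>C \<and>\<^sub>C \<psi> \<in> W"
    by (rule chl_arrow_conj[OF W])
  then have 3: "\<eta> \<and>\<^sub>C \<psi> \<rightarrow>\<^sub>C \<psi> \<in> W"
    by (rule chl_arrow_cong[OF W]) (auto simp: chl.conj_mem_iff chl_one_mem)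
  show "\<phi> \<rightarrow>\<^sub>C \<psi> \<in> W"
    by (rule chl_arrow_trans[OF W imp chl_arrow_trans[OF W 1 chl_arrow_trans[OF W 2 3]]])
qed

section \<open>The translations\<close>

interpretation il: positive_logic "\<lambda>\<phi>. \<Gamma> \<turnstile>\<^sub>I\<^sub>L \<phi>" IImp IAnd IOr for \<Gamma>
  by unfold_locales (rule il_derives.intros; assumption)+

lemma il_zero_mem: "il.closed_theory \<Gamma> W \<Longrightarrow> 0\<^sub>I \<in> W \<Longrightarrow> \<phi> \<in> W"
  by (rule il.closed_theory_thm_mp[OF _ il_zero])

text \<open>The second conjunct of the translation holds automatically: the negation of
  \<open>\<tau> \<phi>\<close> refutes every conjunction that contains
  \<open>\<tau> \<phi>\<close>.\<close>

lemma tau_imp_mem_iff: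
  assumes "il.closed_theory \<Gamma> W"
  shows "\<tau> (\<phi> \<Rightarrow>\<^sub>C \<psi>) \<in> W \<longleftrightarrow>
    (\<forall>V. il.closed_theory \<Gamma> V \<longrightarrow> W \<subseteq> V \<longrightarrow> \<tau> \<phi> \<in> V \<longrightarrow> \<tau> \<psi> \<in> V)"
  using assms by (auto simp: il.conj_mem_iff il.imp_mem_iff)

lemma tau_rho_mem_iff: "il.closed_theory \<Gamma> W \<Longrightarrow> \<tau> (\<rho> \<phi>) \<in> W \<longleftrightarrow> \<phi> \<in> W"
proof (induction \<phi> arbitrary: W)
  case (IOr \<phi> \<psi>)
  then show ?case
    by (simp, intro il.disj_mem_cong)
next
  case (IImp \<phi> \<psi>)
  then show ?case
    using tau_imp_mem_iff[of \<Gamma> W "\<rho> \<phi>" "\<rho> \<psi>"] by (simp add: il.imp_mem_iff)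
qed (auto simp: il.conj_mem_iff)

text \<open>The arrow case is \<open>chl_arrow_mem_iff\<close>. Negations in IL come back as
  \<Rightarrow> 0 rather than \<rightarrow> 0, a difference removed by
  \<open>chl_not_mem_iff\<close>.\<close>

lemma rho_tau_mem_iff: "chl.closed_theory \<Gamma> W \<Longrightarrow> \<rho> (\<tau> \<phi>) \<in> W \<longleftrightarrow> \<phi> \<in> W"
proof (induction \<phi> arbitrary: W)
  case (COr \<phi> \<psi>)
  then show ?case
    by (simp, intro chl.disj_mem_cong)
next
  case (CArrow \<phi> \<psi>)
  then show ?case
    by (simp add: chl.conj_mem_iff chl.imp_mem_iff chl_arrow_mem_iff[of \<Gamma> W \<phi> \<psi>]
        chl_not_mem_iff)
qed (auto simp: chl.conj_mem_iff)

text \<open>Since \<rho> sends implication to the unfolded \<open>\<Rightarrow>\<^sub>C\<close>,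
  every IL axiom except ex falso becomes a CHL1 axiom verbatim.\<close>

lemma rho_sound:
  assumes "\<Delta> \<turnstile>\<^sub>I\<^sub>L \<phi>" "\<And>\<delta>. \<delta> \<in> \<Delta> \<Longrightarrow> \<Gamma> \<turnstile>\<^sub>C\<^sub>H\<^sub>L \<rho> \<delta>"
  shows "\<Gamma> \<turnstile>\<^sub>C\<^sub>H\<^sub>L \<rho> \<phi>"
  using assms
proof (induction rule: il_derives.induct)
  case (il_zero \<phi>)
  show ?case
    using CHL1_mp[OF CHL2 CHL3] by simp
qed (auto intro: chl_derives.intros)

section \<open>Consistent theories deciding finitely many formulas\<close>

definition il_decides :: "'v il_fm set \<Rightarrow> 'v il_fm \<Rightarrow> bool" where
  "il_decides W \<phi> \<longleftrightarrow> (\<phi> \<in> W \<and> \<not>\<^sub>I \<phi> \<notin> W) \<or> (\<phi> \<notin> W \<and> \<not>\<^sub>I \<phi> \<in> W)"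

lemma il_not_mem_iff:
  assumes "il.closed_theory \<Gamma> W"
  shows "\<not>\<^sub>I \<phi> \<in> W \<longleftrightarrow> (\<forall>V. il.closed_theory \<Gamma> V \<longrightarrow> W \<subseteq> V \<longrightarrow> 0\<^sub>I \<notin> V \<longrightarrow> \<phi> \<notin> V)"
  using assms by (auto simp: il.imp_mem_iff)

lemma il_decidesI:
  assumes "il.closed_theory \<Gamma> W" "0\<^sub>I \<notin> W" "\<phi> \<in> W \<or> \<not>\<^sub>I \<phi> \<in> W"
  shows "il_decides W \<phi>"
  using il.closed_theory_mp[OF assms(1)] assms(2,3) unfolding il_decides_def by blast

lemma il_decides_extension:
  assumes "il.closed_theory \<Gamma> V" "W \<subseteq> V" "0\<^sub>I \<notin> V" "il_decides W \<phi>"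
  shows "\<phi> \<in> V \<longleftrightarrow> \<phi> \<in> W"
  using il.closed_theory_mp[OF assms(1)] assms(2-) unfolding il_decides_def by blast

text \<open>Formulas are settled one at a time: if the negation of \<phi> is missing, some
  consistent extension contains \<phi>.\<close>

lemma il_deciding_extension:
  assumes "finite F" "il.closed_theory \<Gamma> W" "0\<^sub>I \<notin> W"
  obtains V where "il.closed_theory \<Gamma> V" "W \<subseteq> V" "0\<^sub>I \<notin> V" "\<forall>\<phi>\<in>F. il_decides V \<phi>"
proof -
  \<comment> \<open>The induction uses the inclusive alternative because it persists in larger
    theories; consistency makes it exclusive at the end.\<close>
  have "\<exists>V. il.closed_theory \<Gamma> V \<and> W \<subseteq> V \<and> 0\<^sub>I \<notin> V \<and> (\<forall>\<phi>\<in>F. \<phi> \<in> V \<or> \<not>\<^sub>I \<phi> \<in> V)"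
    using assms(1)
  proof (induction F rule: finite_induct)
    case empty
    then show ?case using assms by blast
  next
    case (insert \<phi> F)
    then obtain V where V: "il.closed_theory \<Gamma> V" "W \<subseteq> V" "0\<^sub>I \<notin> V"
      "\<forall>\<phi>\<in>F. \<phi> \<in> V \<or> \<not>\<^sub>I \<phi> \<in> V"
      by blast
    show ?case
    proof (cases "\<not>\<^sub>I \<phi> \<in> V")
      case True
      then show ?thesis using V by blast
    next
      case False
      then obtain U where "il.closed_theory \<Gamma> U" "V \<subseteq> U" "0\<^sub>I \<notin> U" "\<phi> \<in> U"
        using il_not_mem_iff[OF V(1)] by blast
      then show ?thesis using V by blast
    qed
  qed
  then show ?thesis
    by (auto intro: that il_decidesI)
qed

text \<open>
  The backward half of an arrow is negative, so by Glivenko's argument it may be checked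
  classically, in consistent theories that decide any prescribed finite set of formulas.
\<close>

lemma tau_arrow_memI:
  assumes W: "il.closed_theory \<Gamma> W" and F: "finite F"
    and forward: "\<And>V. il.closed_theory \<Gamma> V \<Longrightarrow> W \<subseteq> V \<Longrightarrow> \<tau> \<phi> \<in> V \<Longrightarrow> \<tau> \<psi> \<in> V"
    and backward: "\<And>V. il.closed_theory \<Gamma> V \<Longrightarrow> W \<subseteq> V \<Longrightarrow> 0\<^sub>I \<notin> V \<Longrightarrow>
      \<forall>\<theta>\<in>F. il_decides V \<theta> \<Longrightarrow> \<tau> \<psi> \<in> V \<Longrightarrow> \<tau> \<phi> \<in> V"
  shows "\<tau> (\<phi> \<rightarrow>\<^sub>C \<psi>) \<in> W"
proof -
  have "\<not>\<^sub>I \<tau> \<psi> \<in> V" if V: "il.closed_theory \<Gamma> V" "W \<subseteq> V" "\<not>\<^sub>I \<tau> \<phi> \<in> V" for V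
    unfolding il_not_mem_iff[OF V(1)]
  proof (intro allI impI notI)
    fix U assume U: "il.closed_theory \<Gamma> U" "V \<subseteq> U" "0\<^sub>I \<notin> U" "\<tau> \<psi> \<in> U"
    \<comment> \<open>In \<open>X\<close> the classical argument \<open>backward\<close> yields
      \<open>\<tau> \<phi>\<close>, against its negation inherited from \<open>V\<close>.\<close>
    obtain X where X: "il.closed_theory \<Gamma> X" "U \<subseteq> X" "0\<^sub>I \<notin> X" "\<forall>\<theta>\<in>F. il_decides X \<theta>"
      using il_deciding_extension[OF F U(1,3)] .
    then have "\<tau> \<phi> \<in> X"
      using backward U V by blast
    then show False
      using il.closed_theory_mp[OF X(1)] X(2,3) U(2) V(3) by blast
  qed
  then have "\<not>\<^sub>I \<tau> \<phi> \<Rightarrow>\<^sub>I \<not>\<^sub>I \<tau> \<psi> \<in> W"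
    unfolding il.imp_mem_iff[OF W] by blast
  moreover have "\<tau> \<phi> \<Rightarrow>\<^sub>I \<tau> \<psi> \<in> W"
    unfolding il.imp_mem_iff[OF W] using forward by blast
  ultimately show ?thesis
    by (simp add: il.conj_mem_iff[OF W])
qed

text \<open>Classically the translated arrow is the biconditional. Since it is decided again, nested
  arrows can be evaluated too, and backward halves become truth-table checks.\<close>

lemma tau_arrow_mem_decided:
  assumes W: "il.closed_theory \<Gamma> W" "0\<^sub>I \<notin> W"
    and dec: "il_decides W (\<tau> \<phi>)" "il_decides W (\<tau> \<psi>)"
  shows "\<tau> (\<phi> \<rightarrow>\<^sub>C \<psi>) \<in> W \<longleftrightarrow> (\<tau> \<phi> \<in> W \<longleftrightarrow> \<tau> \<psi> \<in> W)" "il_decides W (\<tau> (\<phi> \<rightarrow>\<^sub>C \<psi>))"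
proof -
  have arrow: "\<tau> (\<phi> \<rightarrow>\<^sub>C \<psi>) \<in> W" if "\<tau> \<phi> \<in> W \<longleftrightarrow> \<tau> \<psi> \<in> W"
  \<comment> \<open>No further formulas have to be decided: consistent extensions keep the verdicts
    of \<open>W\<close>, and inconsistent ones contain everything.\<close>
  proof (rule tau_arrow_memI[OF W(1), of "{}"])
    fix V assume V: "il.closed_theory \<Gamma> V" "W \<subseteq> V"
    show "\<tau> \<psi> \<in> V" if "\<tau> \<phi> \<in> V"
      using \<open>\<tau> \<phi> \<in> W \<longleftrightarrow> \<tau> \<psi> \<in> W\<close> that il_decides_extension[OF V] il_zero_mem[OF V(1)] dec by blast
    show "\<tau> \<phi> \<in> V" if "\<tau> \<psi> \<in> V" "0\<^sub>I \<notin> V"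
      using \<open>\<tau> \<phi> \<in> W \<longleftrightarrow> \<tau> \<psi> \<in> W\<close> that il_decides_extension[OF V] dec by blast
  qed simp
  have not_arrow: "\<not>\<^sub>I \<tau> (\<phi> \<rightarrow>\<^sub>C \<psi>) \<in> W" if "\<not> (\<tau> \<phi> \<in> W \<longleftrightarrow> \<tau> \<psi> \<in> W)"
    unfolding il_not_mem_iff[OF W(1)]
  proof (intro allI impI notI)
    fix V assume V: "il.closed_theory \<Gamma> V" "W \<subseteq> V" "0\<^sub>I \<notin> V" "\<tau> (\<phi> \<rightarrow>\<^sub>C \<psi>) \<in> V"
    then have "\<tau> \<phi> \<Rightarrow>\<^sub>I \<tau> \<psi> \<in> V" "\<not>\<^sub>I \<tau> \<phi> \<Rightarrow>\<^sub>I \<not>\<^sub>I \<tau> \<psi> \<in> V"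
      by (simp_all add: il.conj_mem_iff)
    from this[THEN il.closed_theory_mp[OF V(1)]]
    have "\<tau> \<phi> \<in> V \<longrightarrow> \<tau> \<psi> \<in> V" "\<not>\<^sub>I \<tau> \<phi> \<in> V \<longrightarrow> \<not>\<^sub>I \<tau> \<psi> \<in> V"
      by simp_all
    moreover have "\<not> (\<not>\<^sub>I \<tau> \<psi> \<in> V \<and> \<tau> \<psi> \<in> V)"
      using il.closed_theory_mp[OF V(1)] V(3) by blast
    ultimately show False
      using that dec V(2) il_decides_extension[OF V(1-3) dec(1)] il_decides_extension[OF V(1-3) dec(2)]
      unfolding il_decides_def by blast
  qed
  show "il_decides W (\<tau> (\<phi> \<rightarrow>\<^sub>C \<psi>))"
    using il_decidesI[OF W] arrow not_arrow by blast
  then show "\<tau> (\<phi> \<rightarrow>\<^sub>C \<psi>) \<in> W \<longleftrightarrow> (\<tau> \<phi> \<in> W \<longleftrightarrow> \<tau> \<psi> \<in> W)"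
    using arrow not_arrow unfolding il_decides_def by blast
qed

lemma il_decides_zero:
  assumes "il.closed_theory \<Gamma> W" "0\<^sub>I \<notin> W"
  shows "il_decides W (\<tau> 0\<^sub>C)"
  using il_decidesI[OF assms] il.closed_theory_extension(3)[OF assms(1)] by simp

section \<open>Validity of the translated CHL axioms\<close>

lemma tau_arrow_mp:
  assumes "il.closed_theory \<Gamma> W" "\<tau> (\<phi> \<rightarrow>\<^sub>C \<psi>) \<in> W" "\<tau> \<phi> \<in> W"
  shows "\<tau> \<psi> \<in> W"
  using il.closed_theory_mp[OF assms(1)] assms(2,3) by (auto simp: il.conj_mem_iff[OF assms(1)])

lemma tau_arrow_trans:
  assumes W: "il.closed_theory \<Gamma> W" and "\<tau> (\<phi> \<rightarrow>\<^sub>C \<psi>) \<in> W" "\<tau> (\<psi> \<rightarrow>\<^sub>C \<chi>) \<in> W"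
  shows "\<tau> (\<phi> \<rightarrow>\<^sub>C \<chi>) \<in> W"
  using assms(2,3) by (simp add: il.conj_mem_iff[OF W] il.imp_mem_iff[OF W])

text \<open>The forward halves amount to transitivity. Both backward halves hold because, with
  arrows read as biconditionals, the axiom is a classical tautology.\<close>

lemma tau_CHL5:
  assumes W: "il.closed_theory \<Gamma> W"
  shows "\<tau> ((\<phi> \<rightarrow>\<^sub>C \<psi>) \<rightarrow>\<^sub>C ((\<psi> \<rightarrow>\<^sub>C \<chi>) \<rightarrow>\<^sub>C (\<phi> \<rightarrow>\<^sub>C \<chi>))) \<in> W"
proof (rule tau_arrow_memI[OF W, of "{\<tau> \<phi>, \<tau> \<psi>, \<tau> \<chi>}"])
  fix V assume V: "il.closed_theory \<Gamma> V" "W \<subseteq> V"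
  show "\<tau> ((\<psi> \<rightarrow>\<^sub>C \<chi>) \<rightarrow>\<^sub>C (\<phi> \<rightarrow>\<^sub>C \<chi>)) \<in> V" if arrow: "\<tau> (\<phi> \<rightarrow>\<^sub>C \<psi>) \<in> V"
  proof (rule tau_arrow_memI[OF V(1), of "{\<tau> \<phi>, \<tau> \<psi>, \<tau> \<chi>}"])
    fix U assume U: "il.closed_theory \<Gamma> U" "V \<subseteq> U"
    show "\<tau> (\<phi> \<rightarrow>\<^sub>C \<chi>) \<in> U" if "\<tau> (\<psi> \<rightarrow>\<^sub>C \<chi>) \<in> U"
      using tau_arrow_trans[OF U(1) _ that] arrow U by blast
    assume "0\<^sub>I \<notin> U" "\<forall>\<theta>\<in>{\<tau> \<phi>, \<tau> \<psi>, \<tau> \<chi>}. il_decides U \<theta>" "\<tau> (\<phi> \<rightarrow>\<^sub>C \<chi>) \<in> U"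
    moreover have "\<tau> (\<phi> \<rightarrow>\<^sub>C \<psi>) \<in> U"
      using arrow U by blast
    ultimately show "\<tau> (\<psi> \<rightarrow>\<^sub>C \<chi>) \<in> U"
      using tau_arrow_mem_decided[OF U(1)] by simp
  qed simp
  assume "0\<^sub>I \<notin> V" "\<forall>\<theta>\<in>{\<tau> \<phi>, \<tau> \<psi>, \<tau> \<chi>}. il_decides V \<theta>"
    "\<tau> ((\<psi> \<rightarrow>\<^sub>C \<chi>) \<rightarrow>\<^sub>C (\<phi> \<rightarrow>\<^sub>C \<chi>)) \<in> V"
  then show "\<tau> (\<phi> \<rightarrow>\<^sub>C \<psi>) \<in> V"
    using tau_arrow_mem_decided[OF V(1)] by (simp del: tau.simps(6)) blast
qed simp

lemma tau_CHL6:
  assumes W: "il.closed_theory \<Gamma> W"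
  shows "\<tau> ((\<phi> \<rightarrow>\<^sub>C \<psi>) \<rightarrow>\<^sub>C \<not>\<^sub>C (\<phi> \<rightarrow>\<^sub>C \<not>\<^sub>C \<psi>)) \<in> W"
proof (rule tau_arrow_memI[OF W, of "{\<tau> \<phi>, \<tau> \<psi>}"])
  fix V assume V: "il.closed_theory \<Gamma> V" "W \<subseteq> V"
  show "\<tau> (\<not>\<^sub>C (\<phi> \<rightarrow>\<^sub>C \<not>\<^sub>C \<psi>)) \<in> V" if arrow: "\<tau> (\<phi> \<rightarrow>\<^sub>C \<psi>) \<in> V"
  proof (rule tau_arrow_memI[OF V(1), of "{}"])
    fix U assume U: "il.closed_theory \<Gamma> U" "V \<subseteq> U" and not: "\<tau> (\<phi> \<rightarrow>\<^sub>C \<not>\<^sub>C \<psi>) \<in> U"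
    show "\<tau> 0\<^sub>C \<in> U"
    proof (rule ccontr)
      assume "\<tau> 0\<^sub>C \<notin> U"
      \<comment> \<open>A contradiction may also be sought classically: in \<open>X\<close>, \<phi>
        would have to agree in truth value with both \<psi> and its negation.\<close>
      then obtain X where X: "il.closed_theory \<Gamma> X" "U \<subseteq> X" "0\<^sub>I \<notin> X"
        "\<forall>\<theta>\<in>{\<tau> \<phi>, \<tau> \<psi>}. il_decides X \<theta>"
        using il_deciding_extension[OF _ U(1), of "{\<tau> \<phi>, \<tau> \<psi>}"] by auto
      moreover have "\<tau> (\<phi> \<rightarrow>\<^sub>C \<psi>) \<in> X" "\<tau> (\<phi> \<rightarrow>\<^sub>C \<not>\<^sub>C \<psi>) \<in> X"
        using arrow not U X by blast+
      ultimately show False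
        using tau_arrow_mem_decided[OF X(1)] il_decides_zero[OF X(1)]
        by (simp del: tau.simps(6))
    qed
  next
    fix U assume "il.closed_theory \<Gamma> U" "0\<^sub>I \<notin> U" "\<tau> 0\<^sub>C \<in> U"
    then show "\<tau> (\<phi> \<rightarrow>\<^sub>C \<not>\<^sub>C \<psi>) \<in> U" by simp
  qed simp
  assume "0\<^sub>I \<notin> V" "\<forall>\<theta>\<in>{\<tau> \<phi>, \<tau> \<psi>}. il_decides V \<theta>" "\<tau> (\<not>\<^sub>C (\<phi> \<rightarrow>\<^sub>C \<not>\<^sub>C \<psi>)) \<in> V"
  then show "\<tau> (\<phi> \<rightarrow>\<^sub>C \<psi>) \<in> V"
    using tau_arrow_mem_decided[OF V(1)] il_decides_zero[OF V(1)]
    by (simp del: tau.simps(6))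
qed simp

lemma tau_impI:
  assumes "il.closed_theory \<Gamma> W"
    and "\<And>V. il.closed_theory \<Gamma> V \<Longrightarrow> W \<subseteq> V \<Longrightarrow> \<tau> \<phi> \<in> V \<Longrightarrow> \<tau> \<psi> \<in> V"
  shows "\<tau> (\<phi> \<Rightarrow>\<^sub>C \<psi>) \<in> W"
  unfolding tau_imp_mem_iff[OF assms(1)] using assms(2) by blast

lemma tau_imp_mp:
  assumes "il.closed_theory \<Gamma> W" "\<tau> (\<phi> \<Rightarrow>\<^sub>C \<psi>) \<in> W" "\<tau> \<phi> \<in> W"
  shows "\<tau> \<psi> \<in> W"
  using assms(2,3) unfolding tau_imp_mem_iff[OF assms(1)] using assms(1) by blast

text \<open>An arrow to or from 0 has one trivial conjunct, by the theorem 0 \<Rightarrow> 0 or by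
  ex falso; the other reduces to negation. The agreement of the two arrows validates CHL3.\<close>

lemma tau_not_iff:
  assumes "il.closed_theory \<Gamma> W"
  shows "\<tau> (\<not>\<^sub>C \<phi>) \<in> W \<longleftrightarrow> \<not>\<^sub>I \<tau> \<phi> \<in> W"
    and "\<tau> (0\<^sub>C \<rightarrow>\<^sub>C \<phi>) \<in> W \<longleftrightarrow> \<not>\<^sub>I \<tau> \<phi> \<in> W"
proof -
  have not_zero: "\<not>\<^sub>I 0\<^sub>I \<in> W"
    by (rule il.closed_theory_extension(3)[OF assms])
  then have "\<alpha> \<Rightarrow>\<^sub>I \<not>\<^sub>I 0\<^sub>I \<in> W" for \<alpha>
    by (rule il.closed_theory_thm_mp[OF assms il_K])
  then show "\<tau> (\<not>\<^sub>C \<phi>) \<in> W \<longleftrightarrow> \<not>\<^sub>I \<tau> \<phi> \<in> W"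
    by (simp add: il.conj_mem_iff[OF assms])
  have "0\<^sub>I \<Rightarrow>\<^sub>I \<tau> \<phi> \<in> W"
    by (rule il.closed_theory_thm[OF assms il_zero])
  moreover have "\<not>\<^sub>I 0\<^sub>I \<Rightarrow>\<^sub>I \<not>\<^sub>I \<tau> \<phi> \<in> W \<longleftrightarrow> \<not>\<^sub>I \<tau> \<phi> \<in> W"
    using il.closed_theory_mp[OF assms _ not_zero] il.closed_theory_thm_mp[OF assms il_K] by blast
  ultimately show "\<tau> (0\<^sub>C \<rightarrow>\<^sub>C \<phi>) \<in> W \<longleftrightarrow> \<not>\<^sub>I \<tau> \<phi> \<in> W"
    by (simp add: il.conj_mem_iff[OF assms])
qed

lemma tau_arrow_cong:
  assumes W: "il.closed_theory \<Gamma> W" and arrow: "\<tau> (\<phi> \<rightarrow>\<^sub>C \<psi>) \<in> W"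
    and \<phi>: "\<And>V. il.closed_theory \<Gamma> V \<Longrightarrow> \<tau> \<phi> \<in> V \<longleftrightarrow> \<tau> \<phi>' \<in> V"
    and \<psi>: "\<And>V. il.closed_theory \<Gamma> V \<Longrightarrow> \<tau> \<psi> \<in> V \<longleftrightarrow> \<tau> \<psi>' \<in> V"
  shows "\<tau> (\<phi>' \<rightarrow>\<^sub>C \<psi>') \<in> W"
proof (rule tau_arrow_memI[OF W, of "{\<tau> \<phi>, \<tau> \<psi>}"])
  fix V assume V: "il.closed_theory \<Gamma> V" "W \<subseteq> V"
  have arrowV: "\<tau> (\<phi> \<rightarrow>\<^sub>C \<psi>) \<in> V"
    using arrow V(2) by blast
  show "\<tau> \<psi>' \<in> V" if "\<tau> \<phi>' \<in> V"
    using tau_arrow_mp[OF V(1) arrowV] that \<phi>[OF V(1)] \<psi>[OF V(1)] by blast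
  show "\<tau> \<phi>' \<in> V" if "0\<^sub>I \<notin> V" "\<forall>\<theta>\<in>{\<tau> \<phi>, \<tau> \<psi>}. il_decides V \<theta>" "\<tau> \<psi>' \<in> V"
    using tau_arrow_mem_decided(1)[OF V(1) that(1), of \<phi> \<psi>] that arrowV \<phi>[OF V(1)] \<psi>[OF V(1)]
    by blast
qed simp

text \<open>Only \<phi> and \<psi> have to be decided, since membership of a conjunction is
  componentwise in every closed theory.\<close>

lemma tau_CHL9:
  assumes W: "il.closed_theory \<Gamma> W" and arrow: "\<tau> (\<phi> \<rightarrow>\<^sub>C \<psi>) \<in> W"
  shows "\<tau> ((\<phi> \<and>\<^sub>C \<chi>) \<rightarrow>\<^sub>C (\<psi> \<and>\<^sub>C \<chi>)) \<in> W"
proof (rule tau_arrow_memI[OF W, of "{\<tau> \<phi>, \<tau> \<psi>}"])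
  fix V assume V: "il.closed_theory \<Gamma> V" "W \<subseteq> V"
  have arrowV: "\<tau> (\<phi> \<rightarrow>\<^sub>C \<psi>) \<in> V"
    using arrow V(2) by blast
  show "\<tau> (\<psi> \<and>\<^sub>C \<chi>) \<in> V" if "\<tau> (\<phi> \<and>\<^sub>C \<chi>) \<in> V"
    using tau_arrow_mp[OF V(1) arrowV] that by (simp add: il.conj_mem_iff[OF V(1)])
  show "\<tau> (\<phi> \<and>\<^sub>C \<chi>) \<in> V"
    if "0\<^sub>I \<notin> V" "\<forall>\<theta>\<in>{\<tau> \<phi>, \<tau> \<psi>}. il_decides V \<theta>" "\<tau> (\<psi> \<and>\<^sub>C \<chi>) \<in> V"
    using tau_arrow_mem_decided(1)[OF V(1) that(1), of \<phi> \<psi>] that arrowV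
    by (simp add: il.conj_mem_iff[OF V(1)] del: tau.simps(6))
qed simp

text \<open>Here \<chi> is decided as well, so that a disjunction in the theory yields one of its
  disjuncts.\<close>

lemma tau_CHL10:
  assumes W: "il.closed_theory \<Gamma> W" and arrow: "\<tau> (\<phi> \<rightarrow>\<^sub>C \<psi>) \<in> W"
  shows "\<tau> ((\<phi> \<or>\<^sub>C \<chi>) \<rightarrow>\<^sub>C (\<psi> \<or>\<^sub>C \<chi>)) \<in> W"
proof (rule tau_arrow_memI[OF W, of "{\<tau> \<phi>, \<tau> \<psi>, \<tau> \<chi>}"])
  fix V assume V: "il.closed_theory \<Gamma> V" "W \<subseteq> V"
  have arrowV: "\<tau> (\<phi> \<rightarrow>\<^sub>C \<psi>) \<in> V"
    using arrow V(2) by blast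
  show "\<tau> (\<psi> \<or>\<^sub>C \<chi>) \<in> V" if "\<tau> (\<phi> \<or>\<^sub>C \<chi>) \<in> V"
  proof (rule il.disj_memE[OF V(1) that[unfolded tau.simps(5)]])
    fix U assume U: "il.closed_theory \<Gamma> U" "V \<subseteq> U"
    show "\<tau> (\<psi> \<or>\<^sub>C \<chi>) \<in> U" if "\<tau> \<phi> \<in> U"
      using tau_arrow_mp[OF U(1) _ that] il.disj_memI[OF U(1)] arrowV U(2) by auto
    show "\<tau> (\<psi> \<or>\<^sub>C \<chi>) \<in> U" if "\<tau> \<chi> \<in> U"
      using il.disj_memI[OF U(1)] that by simp
  qed
  assume V0: "0\<^sub>I \<notin> V" and dec: "\<forall>\<theta>\<in>{\<tau> \<phi>, \<tau> \<psi>, \<tau> \<chi>}. il_decides V \<theta>"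
    and disj: "\<tau> (\<psi> \<or>\<^sub>C \<chi>) \<in> V"
  \<comment> \<open>If both disjuncts were rejected, every extension containing either would be
    inconsistent, and disjunction elimination would put 0 into \<open>V\<close>.\<close>
  have "\<tau> \<psi> \<in> V \<or> \<tau> \<chi> \<in> V"
  proof (rule ccontr)
    assume none: "\<not> (\<tau> \<psi> \<in> V \<or> \<tau> \<chi> \<in> V)"
    have "0\<^sub>I \<in> V"
    proof (rule il.disj_memE[OF V(1) disj[unfolded tau.simps(5)]])
      fix U assume U: "il.closed_theory \<Gamma> U" "V \<subseteq> U"
      show "0\<^sub>I \<in> U" if "\<tau> \<psi> \<in> U"
        using il_decides_extension[OF U, of "\<tau> \<psi>"] that none dec by blast
      show "0\<^sub>I \<in> U" if "\<tau> \<chi> \<in> U"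
        using il_decides_extension[OF U, of "\<tau> \<chi>"] that none dec by blast
    qed
    with V0 show False ..
  qed
  then have "\<tau> \<phi> \<in> V \<or> \<tau> \<chi> \<in> V"
    using tau_arrow_mem_decided(1)[OF V(1) V0, of \<phi> \<psi>] dec arrowV by blast
  then show "\<tau> (\<phi> \<or>\<^sub>C \<chi>) \<in> V"
    using il.disj_memI[OF V(1)] by simp
qed simp

text \<open>The induction proves membership in all closed theories over the translated hypotheses at
  once. This supplies the premise of CHL7 everywhere, as \<open>tau_arrow_cong\<close>
  requires.\<close>

lemma tau_sound:
  assumes "\<Gamma> \<turnstile>\<^sub>C\<^sub>H\<^sub>L \<phi>"
  shows "\<tau> ` \<Gamma> \<turnstile>\<^sub>I\<^sub>L \<tau> \<phi>"
proof -
  have iffD: "\<tau> \<phi> \<in> V \<longleftrightarrow> \<tau> \<psi> \<in> V"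
    if V: "il.closed_theory (\<tau> ` \<Gamma>) V" and "\<tau> (\<phi> \<Leftrightarrow>\<^sub>C \<psi>) \<in> V" for V \<phi> \<psi>
  proof -
    have "\<tau> (\<phi> \<Rightarrow>\<^sub>C \<psi>) \<in> V" "\<tau> (\<psi> \<Rightarrow>\<^sub>C \<phi>) \<in> V"
      using that(2) unfolding tau.simps(4)[of "\<phi> \<Rightarrow>\<^sub>C \<psi>"] il.conj_mem_iff[OF V] by blast+
    then show ?thesis
      using tau_imp_mp[OF V] by blast
  qed
  have "\<tau> \<phi> \<in> W" if "il.closed_theory (\<tau> ` \<Gamma>) W" for W
    using assms that
  proof (induction arbitrary: W rule: chl_derives.induct)
    case (CHL_hyp \<phi>)
    then show ?case by (auto intro: il.closed_theory_thm il_hyp)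
  next
    case (CHL1_K \<phi> \<psi>)
    show ?case
      by (rule tau_impI[OF CHL1_K], rule tau_impI) blast+
  next
    case (CHL1_S \<phi> \<psi> \<chi>)
    show ?case
    proof (rule tau_impI[OF CHL1_S], rule tau_impI, assumption, rule tau_impI, assumption)
      fix U V X
      assume "\<tau> (\<phi> \<Rightarrow>\<^sub>C \<psi> \<Rightarrow>\<^sub>C \<chi>) \<in> U" "U \<subseteq> V" "\<tau> (\<phi> \<Rightarrow>\<^sub>C \<psi>) \<in> V" "V \<subseteq> X"
        and X: "il.closed_theory (\<tau> ` \<Gamma>) X" "\<tau> \<phi> \<in> X"
      then have "\<tau> (\<phi> \<Rightarrow>\<^sub>C \<psi> \<Rightarrow>\<^sub>C \<chi>) \<in> X" "\<tau> (\<phi> \<Rightarrow>\<^sub>C \<psi>) \<in> X"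
        by blast+
      then show "\<tau> \<chi> \<in> X"
        using tau_imp_mp[OF X(1) tau_imp_mp[OF X(1) _ X(2)] tau_imp_mp[OF X(1) _ X(2)]] by blast
    qed
  next
    case (CHL1_conjE1 \<phi> \<psi>)
    show ?case
      by (rule tau_impI[OF CHL1_conjE1]) (simp add: il.conj_mem_iff)
  next
    case (CHL1_conjE2 \<phi> \<psi>)
    show ?case
      by (rule tau_impI[OF CHL1_conjE2]) (simp add: il.conj_mem_iff)
  next
    case (CHL1_conjI \<phi> \<psi>)
    show ?case
      by (rule tau_impI[OF CHL1_conjI], rule tau_impI) (auto simp: il.conj_mem_iff)
  next
    case (CHL1_disjI1 \<phi> \<psi>)
    show ?case
      by (rule tau_impI[OF CHL1_disjI1]) (simp add: il.disj_memI)
  next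
    case (CHL1_disjI2 \<psi> \<phi>)
    show ?case
      by (rule tau_impI[OF CHL1_disjI2]) (simp add: il.disj_memI)
  next
    case (CHL1_disjE \<phi> \<chi> \<psi>)
    show ?case
    proof (rule tau_impI[OF CHL1_disjE], rule tau_impI, assumption, rule tau_impI, assumption)
      fix U V X
      assume "\<tau> (\<phi> \<Rightarrow>\<^sub>C \<chi>) \<in> U" "U \<subseteq> V" "\<tau> (\<psi> \<Rightarrow>\<^sub>C \<chi>) \<in> V" "V \<subseteq> X"
        and X: "il.closed_theory (\<tau> ` \<Gamma>) X" "\<tau> (\<phi> \<or>\<^sub>C \<psi>) \<in> X"
      then have imps: "\<tau> (\<phi> \<Rightarrow>\<^sub>C \<chi>) \<in> X" "\<tau> (\<psi> \<Rightarrow>\<^sub>C \<chi>) \<in> X"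
        by blast+
      show "\<tau> \<chi> \<in> X"
      proof (rule il.disj_memE[OF X(1) X(2)[unfolded tau.simps(5)]])
        fix Y assume Y: "il.closed_theory (\<tau> ` \<Gamma>) Y" "X \<subseteq> Y"
        show "\<tau> \<chi> \<in> Y" if "\<tau> \<phi> \<in> Y"
          using tau_imp_mp[OF Y(1) _ that] imps(1) Y(2) by blast
        show "\<tau> \<chi> \<in> Y" if "\<tau> \<psi> \<in> Y"
          using tau_imp_mp[OF Y(1) _ that] imps(2) Y(2) by blast
      qed
    qed
  next
    case CHL1_one
    then show ?case by (auto intro: il.closed_theory_thm il_one)
  next
    case (CHL1_mp \<phi> \<psi>)
    show ?case
      by (rule tau_imp_mp[OF CHL1_mp.prems CHL1_mp.IH(2)[OF CHL1_mp.prems]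
            CHL1_mp.IH(1)[OF CHL1_mp.prems]])
  next
    case (CHL2 \<phi>)
    show ?case
      unfolding tau_not_iff(1)[OF CHL2] by (simp add: il.closed_theory_thm[OF CHL2 il_conjE1])
  next
    case (CHL3 \<phi>)
    show ?case
      by (rule tau_impI[OF CHL3]) (simp add: tau_not_iff del: tau.simps(6))
  next
    case (CHL4 \<phi> \<psi>)
    show ?case
      by (rule tau_impI[OF CHL4], rule tau_impI, assumption, rule tau_arrow_mp) blast+
  next
    case (CHL5 \<phi> \<psi> \<chi>)
    then show ?case by (rule tau_CHL5)
  next
    case (CHL6 \<phi> \<psi>)
    then show ?case by (rule tau_CHL6)
  next
    case (CHL7_left \<phi> \<psi> \<chi>)
    show ?case
      by (rule tau_impI[OF CHL7_left.prems], erule (1) tau_arrow_cong)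
        (simp_all only: iffD[OF _ CHL7_left.IH])
  next
    case (CHL7_right \<phi> \<psi> \<chi>)
    show ?case
      by (rule tau_impI[OF CHL7_right.prems], erule (1) tau_arrow_cong)
        (simp_all only: iffD[OF _ CHL7_right.IH])
  next
    case (CHL8 \<phi> \<psi>)
    show ?case
    proof (rule tau_impI[OF CHL8])
      fix V assume V: "il.closed_theory (\<tau> ` \<Gamma>) V" and "\<tau> (\<phi> \<and>\<^sub>C \<psi>) \<in> V"
      then have mem: "\<tau> \<phi> \<in> V" "\<tau> \<psi> \<in> V"
        by (simp_all add: il.conj_mem_iff[OF V])
      have "\<tau> (\<phi> \<rightarrow>\<^sub>C \<psi>) \<in> V"
        by (rule tau_arrow_memI[OF V finite.emptyI]) (use mem in blast)+
      with mem show "\<tau> (\<phi> \<and>\<^sub>C (\<phi> \<rightarrow>\<^sub>C \<psi>)) \<in> V"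
        by (simp add: il.conj_mem_iff[OF V] del: tau.simps(6))
    qed
  next
    case (CHL9 \<phi> \<psi> \<chi>)
    then show ?case by (blast intro: tau_impI tau_CHL9)
  next
    case (CHL10 \<phi> \<psi> \<chi>)
    then show ?case by (blast intro: tau_impI tau_CHL10)
  qed
  then show ?thesis by (rule il.thmI)
qed

theorem theorem4p3:
  shows "(\<forall>(\<Gamma> :: 'v chl_fm set) (\<phi> :: 'v chl_fm). \<Gamma> \<turnstile>\<^sub>C\<^sub>H\<^sub>L \<phi> \<longleftrightarrow> \<tau> ` \<Gamma> \<turnstile>\<^sub>I\<^sub>L \<tau> \<phi>)
       \<and> (\<forall>\<phi> :: 'v il_fm. {\<tau> (\<rho> \<phi>)} \<stileturn>\<turnstile>\<^sub>I\<^sub>L {\<phi>})"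
proof (intro conjI allI iffI)
  fix \<Gamma> :: "'v chl_fm set" and \<phi> :: "'v chl_fm"
  have rho_tau: "\<Gamma> \<turnstile>\<^sub>C\<^sub>H\<^sub>L \<rho> (\<tau> \<psi>) \<longleftrightarrow> \<Gamma> \<turnstile>\<^sub>C\<^sub>H\<^sub>L \<psi>" for \<psi>
    by (rule chl.thm_cong) (rule rho_tau_mem_iff)
  assume "\<tau> ` \<Gamma> \<turnstile>\<^sub>I\<^sub>L \<tau> \<phi>"
  \<comment> \<open>Translating the derivation back turns each hypothesis \<gamma> into
    \<open>\<rho> (\<tau> \<gamma>)\<close>, which \<open>rho_tau\<close> makes derivable from
    \<Gamma>.\<close>
  then have "\<Gamma> \<turnstile>\<^sub>C\<^sub>H\<^sub>L \<rho> (\<tau> \<phi>)"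
    by (rule rho_sound) (auto simp: rho_tau intro: CHL_hyp)
  then show "\<Gamma> \<turnstile>\<^sub>C\<^sub>H\<^sub>L \<phi>"
    by (simp add: rho_tau)
next
  fix \<phi> :: "'v il_fm"
  have "\<Delta> \<turnstile>\<^sub>I\<^sub>L \<tau> (\<rho> \<phi>) \<longleftrightarrow> \<Delta> \<turnstile>\<^sub>I\<^sub>L \<phi>" for \<Delta>
    by (rule il.thm_cong) (rule tau_rho_mem_iff)
  then show "{\<tau> (\<rho> \<phi>)} \<stileturn>\<turnstile>\<^sub>I\<^sub>L {\<phi>}"
    using il_hyp by (fastforce simp: il_interderivable_def)
qed (rule tau_sound)

end
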